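(* Let $0<T_{\min}\le T_{\max}<\infty$ and let the growth condition (defined in the context) hold for the family $\mathcal S_{\mathrm{rng}}(T_{\min},T_{\max})$. The following are equivalent: (i) the impulsive system is strongly UGES over $\mathcal S_{\mathrm{rng}}(T_{\min},T_{\max})$; (ii) there exist $p\ge1$, $c\ge1$, $\eta\ge0$, $\mu\in(0,1]$ with $\eta+(-\log\mu)>0$, and a functional $\bar V:[0,T_{\max}]\times X\to\mathbb R_{\ge0}$, Lipschitz on bounded subsets of $X$ uniformly in $\tau$ and continuous in $\tau$, satisfying for all $x\in X$ $$\|x\|^p\le\bar V(\tau,x)\le c\|x\|^p\ \ \forall\tau\in[0,T_{\max}],\qquad \underline D^+\bar V(\tau,x)\le-\eta\bar V(\tau,x)\ \ \forall\tau\in[0,T_{\max}),$$ $$\bar V(0,Jx)\le\mu\bar V(\theta,x)\ \ \forall\theta\in[T_{\min},T_{\max}];$$ (iii) the family $\mathcal M=\{JS(\theta):\theta\in[T_{\min},T_{\max}]\}$ admits a coercive Lipschitz Lyapunov function uniformly: there exist $p\ge1$, $\hat c\ge1$, $\hat\mu\in(0,1)$ and $V_d:X\to\mathbb R_{\ge0}$, Lipschitz on bounded subsets of $X$, such that $\|x\|^p\le V_d(x)\le\hat c\|x\|^p$ and $V_d(Mx)\le\hat\mu V_d(x)$ for all $x\in X$ and all $M\in\mathcal M$.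
   Context: Setting. $X$ is a Banach space with norm $\|\cdot\|$; $A:D(A)\subset X\to X$ generates a strongly continuous ($C_0$) semigroup $(S(t))_{t\ge0}$ on $X$; $J\in L(X)$ is bounded, $J\neq0$, $JD(A)\subset D(A)$. $\mathcal S_{0,\infty}$ is the set of sequences $\sigma=\{t_k\}_{k\ge1}$ with, setting $t_0:=0$, $t_{k+1}>t_k$ for all $k\ge0$ and $t_k\to\infty$; $\mathbb T_\sigma:=\{t_k:k\ge1\}$. $\mathcal S_{\mathrm{rng}}(T_{\min},T_{\max}):=\{\sigma\in\mathcal S_{0,\infty}:T_{\min}\le t_{k+1}-t_k\le T_{\max}\ \forall k\ge0\}$. The impulsive system is $\dot x(t)=Ax(t)$ for $t\notin\mathbb T_\sigma$, $x(t)=Jx(t^-)$ for $t\in\mathbb T_\sigma$. Its propagator $U_\sigma(t,s)$, $t\ge s\ge0$, is: $U_\sigma(t,s)=S(t-s)$ if $(s,t]\cap\mathbb T_\sigma=\varnothing$; otherwise, if $t_l<\dots<t_m$ are the impulse times in $(s,t]$, $U_\sigma(t,s)=S(t-t_m)JS(t_m-t_{m-1})J\cdots JS(t_l-s)$. $\kappa_\sigma(t,s):=\#(\mathbb T_\sigma\cap(s,t])$. Strong UGES over a family $\mathcal S$: there exist $M\ge1$, $\alpha>0$, $\rho\in(0,1)$ such that $\|U_\sigma(t,s)\|\le M\rho^{\kappa_\sigma(t,s)}e^{-\alpha(t-s)}$ for all $t\ge s\ge0$ and all $\sigma\in\mathcal S$. Growth condition for $\mathcal S_{\mathrm{rng}}(T_{\min},T_{\max})$: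 there exist a piecewise continuous $g:\mathbb R_{\ge0}\to\mathbb R_{>0}$ bounded below by some $c_0>0$, and $\mu_0>1$, such that $\|U_\sigma(t,s)x\|\le g(t-s)\mu_0^{\kappa_\sigma(t,s)}\|x\|$ for all $t\ge s\ge0$, $x\in X$, $\sigma\in\mathcal S_{\mathrm{rng}}(T_{\min},T_{\max})$, and $\sup_{0\le\tau<T_{\max}}g(\tau)<\infty$. Functionals. $\bar V$ is Lipschitz on bounded subsets of $X$ uniformly in $\tau$ if for every $r>0$ there is $L_r>0$ with $|\bar V(\tau,x)-\bar V(\tau,y)|\le L_r\|x-y\|$ for all $\|x\|,\|y\|<r$ and all $\tau$ (similarly for $V_d$, without $\tau$). $\underline D^+\bar V(\tau,x):=\liminf_{h\downarrow0}h^{-1}\big(\bar V(\tau+h,S(h)x)-\bar V(\tau,x)\big)$. *)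

theory Defs
  imports "HOL-Analysis.Analysis"
begin

definition C0_semigroup :: "(real \<Rightarrow> 'a::banach \<Rightarrow>\<^sub>L 'a) \<Rightarrow> bool" where
  "C0_semigroup S \<longleftrightarrow>
     S 0 = id_blinfun \<and>
     (\<forall>s\<ge>0. \<forall>t\<ge>0. S (s + t) = S s o\<^sub>L S t) \<and>
     (\<forall>x. ((\<lambda>t. S t x) \<longlongrightarrow> x) (at_right 0))"

(* The unbounded operator is the pair of its domain D and a total function A,
   whose values outside D are irrelevant. *)
definition generates :: "'a set \<Rightarrow> ('a \<Rightarrow> 'a) \<Rightarrow> (real \<Rightarrow> 'a::banach \<Rightarrow>\<^sub>L 'a) \<Rightarrow> bool" where
  "generates D A S \<longleftrightarrow>
     C0_semigroup S \<and>
     D = {x. \<exists>y. ((\<lambda>h. (S h x - x) /\<^sub>R h) \<longlongrightarrow> y) (at_right 0)} \<and>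
     (\<forall>x\<in>D. ((\<lambda>h. (S h x - x) /\<^sub>R h) \<longlongrightarrow> A x) (at_right 0))"

(* A sequence {t_k : k >= 1} is stored together with the convention t_0 = 0;
   t_0 itself is not an impulse time. *)
definition impulse_seqs :: "(nat \<Rightarrow> real) set" where
  "impulse_seqs =
     {\<sigma>. \<sigma> 0 = 0 \<and> (\<forall>k. \<sigma> k < \<sigma> (Suc k)) \<and> filterlim \<sigma> at_top sequentially}"

definition impulse_times :: "(nat \<Rightarrow> real) \<Rightarrow> real set" where
  "impulse_times \<sigma> = \<sigma> ` {1..}"

definition seqs_rng :: "real \<Rightarrow> real \<Rightarrow> (nat \<Rightarrow> real) set" where
  "seqs_rng Tmin Tmax =
     {\<sigma> \<in> impulse_seqs. \<forall>k. Tmin \<le> \<sigma> (Suc k) - \<sigma> k \<and> \<sigma> (Suc k) - \<sigma> k \<le> Tmax}"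

(* Evolution from time s to time t with impulses at the listed times, earliest first:
   for rs = [t_l, ..., t_m] this is S(t - t_m) J S(t_m - t_{m-1}) J ... J S(t_l - s). *)
fun evolve :: "(real \<Rightarrow> 'a::banach \<Rightarrow>\<^sub>L 'a) \<Rightarrow> ('a \<Rightarrow>\<^sub>L 'a) \<Rightarrow> real list \<Rightarrow> real \<Rightarrow> real \<Rightarrow> 'a \<Rightarrow>\<^sub>L 'a" where
  "evolve S J [] t s = S (t - s)"
| "evolve S J (r # rs) t s = evolve S J rs t r o\<^sub>L (J o\<^sub>L S (r - s))"

(* The set of impulse times in (s,t] is finite for every member of impulse_seqs,
   so sorted_list_of_set lists it. *)
definition propagator ::
  "(real \<Rightarrow> 'a::banach \<Rightarrow>\<^sub>L 'a) \<Rightarrow> ('a \<Rightarrow>\<^sub>L 'a) \<Rightarrow> (nat \<Rightarrow> real) \<Rightarrow> real \<Rightarrow> real \<Rightarrow> 'a \<Rightarrow>\<^sub>L 'a" where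
  "propagator S J \<sigma> t s = evolve S J (sorted_list_of_set (impulse_times \<sigma> \<inter> {s<..t})) t s"

definition impulse_count :: "(nat \<Rightarrow> real) \<Rightarrow> real \<Rightarrow> real \<Rightarrow> nat" where
  "impulse_count \<sigma> t s = card (impulse_times \<sigma> \<inter> {s<..t})"

definition strongly_UGES ::
  "(real \<Rightarrow> 'a::banach \<Rightarrow>\<^sub>L 'a) \<Rightarrow> ('a \<Rightarrow>\<^sub>L 'a) \<Rightarrow> (nat \<Rightarrow> real) set \<Rightarrow> bool" where
  "strongly_UGES S J F \<longleftrightarrow>
     (\<exists>M \<alpha> \<rho>. M \<ge> 1 \<and> \<alpha> > 0 \<and> 0 < \<rho> \<and> \<rho> < 1 \<and>
        (\<forall>\<sigma>\<in>F. \<forall>s t. 0 \<le> s \<and> s \<le> t \<longrightarrow>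
           norm (propagator S J \<sigma> t s) \<le> M * \<rho> ^ impulse_count \<sigma> t s * exp (- \<alpha> * (t - s))))"

(* Finitely many discontinuities in every bounded interval, with finite one-sided limits
   everywhere; no left or right continuity is imposed at the discontinuities. *)
definition piecewise_continuous :: "(real \<Rightarrow> real) \<Rightarrow> bool" where
  "piecewise_continuous g \<longleftrightarrow>
     (\<forall>b\<ge>0. finite {t \<in> {0..b}. \<not> continuous (at t within {0..}) g}) \<and>
     (\<forall>t\<ge>0. \<exists>l. (g \<longlongrightarrow> l) (at_right t)) \<and>
     (\<forall>t>0. \<exists>l. (g \<longlongrightarrow> l) (at_left t))"

definition growth_condition ::
  "(real \<Rightarrow> 'a::banach \<Rightarrow>\<^sub>L 'a) \<Rightarrow> ('a \<Rightarrow>\<^sub>L 'a) \<Rightarrow> real \<Rightarrow> real \<Rightarrow> bool" where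
  "growth_condition S J Tmin Tmax \<longleftrightarrow>
     (\<exists>g c\<^sub>0 \<mu>\<^sub>0. piecewise_continuous g \<and> c\<^sub>0 > 0 \<and> (\<forall>t\<ge>0. c\<^sub>0 \<le> g t) \<and> \<mu>\<^sub>0 > 1 \<and>
        (\<forall>\<sigma>\<in>seqs_rng Tmin Tmax. \<forall>s t x. 0 \<le> s \<and> s \<le> t \<longrightarrow>
           norm (propagator S J \<sigma> t s x) \<le> g (t - s) * \<mu>\<^sub>0 ^ impulse_count \<sigma> t s * norm x) \<and>
        bdd_above (g ` {0..<Tmax}))"

definition lipschitz_on_bounded :: "('a::banach \<Rightarrow> real) \<Rightarrow> bool" where
  "lipschitz_on_bounded V \<longleftrightarrow>
     (\<forall>r>0. \<exists>L>0. \<forall>x y. norm x < r \<and> norm y < r \<longrightarrow> \<bar>V x - V y\<bar> \<le> L * norm (x - y))"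

definition lipschitz_on_bounded_unif :: "real set \<Rightarrow> (real \<Rightarrow> 'a::banach \<Rightarrow> real) \<Rightarrow> bool" where
  "lipschitz_on_bounded_unif I V \<longleftrightarrow>
     (\<forall>r>0. \<exists>L>0. \<forall>\<tau>\<in>I. \<forall>x y. norm x < r \<and> norm y < r \<longrightarrow>
        \<bar>V \<tau> x - V \<tau> y\<bar> \<le> L * norm (x - y))"

(* Extended-real valued, since the lower limit may be infinite. *)
definition lower_Dini ::
  "(real \<Rightarrow> 'a::banach \<Rightarrow>\<^sub>L 'a) \<Rightarrow> (real \<Rightarrow> 'a \<Rightarrow> real) \<Rightarrow> real \<Rightarrow> 'a \<Rightarrow> ereal" where
  "lower_Dini S V \<tau> x = Liminf (at_right 0) (\<lambda>h. ereal ((V (\<tau> + h) (S h x) - V \<tau> x) / h))"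

definition clock_Lyapunov ::
  "(real \<Rightarrow> 'a::banach \<Rightarrow>\<^sub>L 'a) \<Rightarrow> ('a \<Rightarrow>\<^sub>L 'a) \<Rightarrow> real \<Rightarrow> real \<Rightarrow>
    real \<Rightarrow> real \<Rightarrow> real \<Rightarrow> real \<Rightarrow> (real \<Rightarrow> 'a \<Rightarrow> real) \<Rightarrow> bool" where
  "clock_Lyapunov S J Tmin Tmax p c \<eta> \<mu> V \<longleftrightarrow>
     (\<forall>\<tau>\<in>{0..Tmax}. \<forall>x. 0 \<le> V \<tau> x) \<and>
     lipschitz_on_bounded_unif {0..Tmax} V \<and>
     (\<forall>x. continuous_on {0..Tmax} (\<lambda>\<tau>. V \<tau> x)) \<and>
     (\<forall>x. (\<forall>\<tau>\<in>{0..Tmax}. norm x powr p \<le> V \<tau> x \<and> V \<tau> x \<le> c * norm x powr p) \<and>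
          (\<forall>\<tau>\<in>{0..<Tmax}. lower_Dini S V \<tau> x \<le> ereal (- \<eta> * V \<tau> x)) \<and>
          (\<forall>\<theta>\<in>{Tmin..Tmax}. V 0 (J x) \<le> \<mu> * V \<theta> x))"

definition uniform_discrete_Lyapunov ::
  "('a::banach \<Rightarrow>\<^sub>L 'a) set \<Rightarrow> real \<Rightarrow> real \<Rightarrow> real \<Rightarrow> ('a \<Rightarrow> real) \<Rightarrow> bool" where
  "uniform_discrete_Lyapunov \<M> p c \<mu> V \<longleftrightarrow>
     (\<forall>x. 0 \<le> V x) \<and>
     lipschitz_on_bounded V \<and>
     (\<forall>x. norm x powr p \<le> V x \<and> V x \<le> c * norm x powr p \<and> (\<forall>M\<in>\<M>. V (M x) \<le> \<mu> * V x))"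

end

theory Submission
  imports Defs
begin

text \<open>
  All three properties are equivalent to one statement about operators in which no impulse
  sequence occurs any more: the products \<open>J S(\<theta>\<^sub>n) \<cdots> J S(\<theta>\<^sub>1)\<close> with all \<open>\<theta>\<^sub>i\<close> in
  \<open>[Tmin, Tmax]\<close> have norm at most \<open>C \<nu>\<^sup>n\<close> for some \<open>\<nu> < 1\<close> (\<open>product_decay\<close>).

  Such a product is the propagator from time 0 to the \<open>n\<close>-th impulse of a sequence whose first
  gaps are the \<open>\<theta>\<^sub>i\<close>, so exponential stability gives the decay (\<open>UGES_imp_product_decay\<close>).
  Conversely, a propagator consists of such a product and of at most two incomplete pieces of
  length at most \<open>Tmax\<close>. The growth condition bounds the semigroup on \<open>[0, Tmax]\<close> and so
  controls these pieces. Since all gaps are at most \<open>Tmax\<close>,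
  the number of impulses grows at least linearly with time, so half of the decay per impulse
  can be traded for exponential decay in time (\<open>product_decay_imp_UGES\<close>).

  A discrete Lyapunov function gives the decay by iteration; the exponent \<open>p\<close> only replaces
  \<open>\<mu>\<close> by its \<open>p\<close>-th root. A clock-dependent Lyapunov function \<open>V\<close> decreases like
  \<open>exp (- \<eta> \<tau>)\<close> along an orbit between two impulses, because a continuous function is controlled
  by its lower Dini derivative, and \<open>V 0\<close> is therefore a discrete Lyapunov function with the
  factor \<open>\<mu> exp (- \<eta> Tmin) < 1\<close> (\<open>clock_Lyapunov_imp_discrete_Lyapunov\<close>).

  The Lyapunov functions in the other direction are suprema of \<open>\<parallel>T x\<parallel>\<close> over the operators \<open>T\<close>
  by which the system can still act on the present state, each divided by \<open>\<nu>\<close> to the number of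
  its impulses. They are Lipschitz seminorms, and they decrease because whatever can act after
  a step can, preceded by that step, act before it. All of them work with \<open>p = 1\<close>; the
  clock-dependent one has \<open>\<eta> = 0\<close> and takes its whole decay from the impulses.
\<close>

section \<open>Suprema of the orbits of a family of operators\<close>

definition sup_norm :: "('a::real_normed_vector \<Rightarrow>\<^sub>L 'b::real_normed_vector) set \<Rightarrow> 'a \<Rightarrow> real" where
  "sup_norm F x = (SUP T\<in>F. norm (blinfun_apply T x))"

lemma sup_norm_upper:
  fixes F :: "('a::real_normed_vector \<Rightarrow>\<^sub>L 'b::real_normed_vector) set"
  assumes "\<And>T. T \<in> F \<Longrightarrow> norm T \<le> C" and "T \<in> F"
  shows "norm (T x) \<le> sup_norm F x"
proof -
  have "norm (blinfun_apply U x) \<le> C * norm x" if "U \<in> F" for U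
    by (rule order_trans[OF norm_blinfun]) (simp add: assms(1) that mult_right_mono)
  then have "bdd_above ((\<lambda>T. norm (blinfun_apply T x)) ` F)" by (intro bdd_aboveI2)
  then show ?thesis unfolding sup_norm_def using assms(2) by (intro cSUP_upper)
qed

lemma sup_norm_least:
  fixes F :: "('a::real_normed_vector \<Rightarrow>\<^sub>L 'b::real_normed_vector) set"
  assumes "F \<noteq> {}" and "\<And>T. T \<in> F \<Longrightarrow> norm T \<le> C"
  shows "sup_norm F x \<le> C * norm x"
  unfolding sup_norm_def
proof (rule cSUP_least)
  fix T assume "T \<in> F"
  then show "norm (T x) \<le> C * norm x"
    by (intro order_trans[OF norm_blinfun]) (simp add: assms(2) mult_right_mono)
qed (rule assms(1))

text \<open>The only way in which suprema are estimated below: matching each member of one family with a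
  member of the other one, possibly at another point and up to a factor and an error. Lipschitz
  and continuity estimates use the error \<open>e\<close>, contraction estimates the factor \<open>k\<close>.\<close>

lemma sup_norm_compare:
  fixes F G :: "('a::real_normed_vector \<Rightarrow>\<^sub>L 'b::real_normed_vector) set"
  assumes "F \<noteq> {}" and bound: "\<And>T. T \<in> G \<Longrightarrow> norm T \<le> C" and "0 \<le> k"
    and match: "\<And>T. T \<in> F \<Longrightarrow> \<exists>U\<in>G. norm (T x) \<le> k * norm (U y) + e"
  shows "sup_norm F x \<le> k * sup_norm G y + e"
  unfolding sup_norm_def[of F]
proof (rule cSUP_least)
  fix T assume "T \<in> F"
  then obtain U where U: "U \<in> G" "norm (T x) \<le> k * norm (U y) + e" using match by blast
  have "k * norm (U y) \<le> k * sup_norm G y"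
    using sup_norm_upper[of G C U y] bound U(1) \<open>0 \<le> k\<close> by (simp add: mult_left_mono)
  then show "norm (T x) \<le> k * sup_norm G y + e" using U(2) by simp
qed (rule assms(1))

lemma sup_norm_lipschitz:
  fixes F :: "('a::real_normed_vector \<Rightarrow>\<^sub>L 'b::real_normed_vector) set"
  assumes "F \<noteq> {}" and bound: "\<And>T. T \<in> F \<Longrightarrow> norm T \<le> C"
  shows "\<bar>sup_norm F x - sup_norm F y\<bar> \<le> C * norm (x - y)"
proof -
  have "sup_norm F u \<le> 1 * sup_norm F v + C * norm (u - v)" for u v
  proof (rule sup_norm_compare[OF assms(1) bound])
    fix T assume T: "T \<in> F"
    have "norm (T u) \<le> norm (T v) + norm (T (u - v))"
      by (metis blinfun.diff_right norm_triangle_sub)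
    also have "norm (T (u - v)) \<le> C * norm (u - v)"
      by (rule order_trans[OF norm_blinfun]) (simp add: bound T mult_right_mono)
    finally show "\<exists>U\<in>F. norm (T u) \<le> 1 * norm (U v) + C * norm (u - v)" using T by force
  qed simp_all
  from this[of x y] this[of y x] show ?thesis by (simp add: norm_minus_commute abs_le_iff)
qed

section \<open>A comparison principle for the lower Dini derivative\<close>

text \<open>Subtracting the expected bound together with a small linear term \<open>\<epsilon> t\<close> makes the difference
  \<open>w\<close> start at 0 with negative slope. At the last point where \<open>w \<le> 0\<close>, the Dini inequality
  yields a slightly later point with the same property, unless the interval has ended. A lower
  limit suffices, since a single later point is needed. The bound \<open>exp u \<ge> 1 + u\<close> replaces a
  differentiation of the exponential; this is where \<open>\<phi> 0 \<ge> 0\<close> enters.\<close>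

lemma lower_Dini_exponential_decay:
  fixes \<phi> :: "real \<Rightarrow> real"
  assumes "0 \<le> b" and "0 \<le> \<eta>" and "0 \<le> \<phi> 0"
    and cont: "continuous_on {0..b} \<phi>"
    and dini: "\<And>t. t \<in> {0..<b} \<Longrightarrow>
      Liminf (at_right 0) (\<lambda>h. ereal ((\<phi> (t + h) - \<phi> t) / h)) \<le> ereal (- \<eta> * \<phi> t)"
  shows "\<phi> b \<le> exp (- \<eta> * b) * \<phi> 0"
proof -
  have main: "\<phi> b \<le> exp (- \<eta> * b) * \<phi> 0 + \<epsilon> * b" if \<epsilon>: "\<epsilon> > 0" for \<epsilon>
  proof -
    \<comment> \<open>The slope of \<open>- \<epsilon> t\<close> absorbs the error that taking a difference quotient instead of
      its lower limit costs.\<close>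
    define w where "w t = \<phi> t - exp (- \<eta> * t) * \<phi> 0 - \<epsilon> * t" for t
    define Z where "Z = {t \<in> {0..b}. w t \<le> 0}"
    have wcont: "continuous_on {0..b} w"
      unfolding w_def by (intro continuous_intros cont)
    have "closed Z" unfolding Z_def
      by (rule continuous_on_closed_Collect_le[OF wcont]) simp_all
    moreover have "0 \<in> Z" using \<open>0 \<le> b\<close> by (simp add: Z_def w_def)
    moreover have bdd: "bdd_above Z" unfolding Z_def by (intro bdd_aboveI[of _ b]) auto
    ultimately have SZ: "Sup Z \<in> Z" by (intro closed_contains_Sup) auto
    define t where "t = Sup Z"
    have t: "0 \<le> t" "t \<le> b" "w t \<le> 0" using SZ by (auto simp: Z_def t_def)
    have "t = b"
    proof (rule ccontr)
      assume "t \<noteq> b"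
      then have tb: "t \<in> {0..<b}" using t by auto
      \<comment> \<open>A step below \<open>1 / (\<eta> + 1)\<close> keeps \<open>1 - \<eta> d\<close> nonnegative, so that \<open>w t \<le> 0\<close> is inherited.\<close>
      define \<delta> where "\<delta> = min (b - t) (1 / (\<eta> + 1))"
      have \<delta>: "0 < \<delta>" using tb \<open>0 \<le> \<eta>\<close> by (simp add: \<delta>_def)
      have "\<not> (\<forall>\<^sub>F h in at_right 0. ereal (- \<eta> * \<phi> t + \<epsilon>) \<le> ereal ((\<phi> (t + h) - \<phi> t) / h))"
      proof
        assume "\<forall>\<^sub>F h in at_right 0. ereal (- \<eta> * \<phi> t + \<epsilon>) \<le> ereal ((\<phi> (t + h) - \<phi> t) / h)"
        then have "ereal (- \<eta> * \<phi> t + \<epsilon>) \<le> ereal (- \<eta> * \<phi> t)"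
          by (rule order_trans[OF Liminf_bounded dini[OF tb]])
        then show False using \<epsilon> by simp
      qed
      then obtain d where d: "0 < d" "d < \<delta>" "(\<phi> (t + d) - \<phi> t) / d < - \<eta> * \<phi> t + \<epsilon>"
        using \<delta> unfolding eventually_at_right_field by (auto simp: not_le)
      have db: "t + d \<le> b" using d by (simp add: \<delta>_def)
      have \<eta>d: "\<eta> * d \<le> 1"
      proof -
        have "d < 1 / (\<eta> + 1)" using d(2) by (simp add: \<delta>_def)
        then have "d * (\<eta> + 1) \<le> 1" using \<open>0 \<le> \<eta>\<close> by (simp add: pos_less_divide_eq)
        then show ?thesis using d(1) by (simp add: algebra_simps)
      qed
      have "\<phi> (t + d) \<le> \<phi> t + d * (- \<eta> * \<phi> t + \<epsilon>)"
        using d(1,3) by (simp add: pos_divide_less_eq mult.commute)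
      moreover have "exp (- \<eta> * t) * \<phi> 0 * (1 - \<eta> * d) \<le> exp (- \<eta> * (t + d)) * \<phi> 0"
      proof -
        have "1 - \<eta> * d \<le> exp (- (\<eta> * d))" using exp_ge_add_one_self[of "- (\<eta> * d)"] by simp
        then have "exp (- \<eta> * t) * \<phi> 0 * (1 - \<eta> * d) \<le> exp (- \<eta> * t) * \<phi> 0 * exp (- (\<eta> * d))"
          using \<open>0 \<le> \<phi> 0\<close> by (intro mult_left_mono) auto
        also have "\<dots> = exp (- \<eta> * (t + d)) * \<phi> 0"
        proof -
          have "exp (- \<eta> * (t + d)) = exp (- \<eta> * t) * exp (- (\<eta> * d))"
            by (simp add: exp_add[symmetric] distrib_left)
          then show ?thesis by (simp only: mult_ac)
        qed
        finally show ?thesis .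
      qed
      ultimately have "w (t + d) \<le> w t * (1 - \<eta> * d) - \<eta> * d * (\<epsilon> * t)"
        unfolding w_def by (simp add: algebra_simps)
      also have "\<dots> \<le> 0"
      proof -
        have "w t * (1 - \<eta> * d) \<le> 0" using t(3) \<eta>d by (simp add: mult_nonpos_nonneg)
        moreover have "0 \<le> \<eta> * d * (\<epsilon> * t)" using \<open>0 \<le> \<eta>\<close> d(1) \<epsilon> t(1) by simp
        ultimately show ?thesis by simp
      qed
      finally have "t + d \<in> Z" using t d db by (simp add: Z_def)
      then have "t + d \<le> t" unfolding t_def using bdd by (rule cSup_upper)
      then show False using d by simp
    qed
    then show ?thesis using t(3) by (simp add: w_def)
  qed
  show ?thesis
  proof (rule field_le_epsilon)
    fix e :: real assume "e > 0"
    then have "\<phi> b \<le> exp (- \<eta> * b) * \<phi> 0 + e / (b + 1) * b" using \<open>0 \<le> b\<close> by (intro main) simp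
    also have "e / (b + 1) * b \<le> e" using \<open>0 \<le> b\<close> \<open>e > 0\<close> by (simp add: field_simps)
    finally show "\<phi> b \<le> exp (- \<eta> * b) * \<phi> 0 + e" by simp
  qed
qed

section \<open>Impulse sequences and the propagator\<close>

fun jump_product ::
  "(real \<Rightarrow> 'a::banach \<Rightarrow>\<^sub>L 'a) \<Rightarrow> ('a \<Rightarrow>\<^sub>L 'a) \<Rightarrow> real list \<Rightarrow> 'a \<Rightarrow>\<^sub>L 'a" where
  "jump_product S J [] = id_blinfun"
| "jump_product S J (\<theta> # \<theta>s) = jump_product S J \<theta>s o\<^sub>L (J o\<^sub>L S \<theta>)"

definition product_decay ::
  "(real \<Rightarrow> 'a::banach \<Rightarrow>\<^sub>L 'a) \<Rightarrow> ('a \<Rightarrow>\<^sub>L 'a) \<Rightarrow> real set \<Rightarrow> real \<Rightarrow> real \<Rightarrow> bool" where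
  "product_decay S J I C \<nu> \<longleftrightarrow> 1 \<le> C \<and> 0 < \<nu> \<and> \<nu> < 1 \<and>
     (\<forall>\<theta>s. set \<theta>s \<subseteq> I \<longrightarrow> norm (jump_product S J \<theta>s) \<le> C * \<nu> ^ length \<theta>s)"

lemma impulse_seqs_strict_mono:
  "\<sigma> \<in> impulse_seqs \<Longrightarrow> strict_mono \<sigma>"
  by (simp add: impulse_seqs_def strict_mono_Suc_iff)

text \<open>Locates \<open>s\<close> in the partition by the \<open>\<sigma> k\<close>; the convention \<open>\<sigma> 0 = 0\<close> makes this possible
  before the first impulse too.\<close>

lemma impulse_bracket:
  assumes "\<sigma> \<in> impulse_seqs" and "0 \<le> s"
  obtains k where "\<sigma> k \<le> s" and "s < \<sigma> (Suc k)"
proof -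
  have "\<forall>\<^sub>F i in sequentially. s < \<sigma> i"
    using assms(1) by (simp add: impulse_seqs_def filterlim_at_top_dense)
  then have ex: "\<exists>i. s < \<sigma> i" by (meson eventually_sequentially order_refl)
  define l where "l = (LEAST i. s < \<sigma> i)"
  have l: "s < \<sigma> l" unfolding l_def using ex by (rule LeastI_ex)
  have "\<sigma> 0 \<le> s" using assms by (simp add: impulse_seqs_def)
  with l obtain k where k: "l = Suc k" by (cases l) auto
  then have "\<not> s < \<sigma> k" using not_less_Least[of k "\<lambda>i. s < \<sigma> i"] by (simp add: l_def)
  with l k show ?thesis by (intro that[of k]) auto
qed

lemma sorted_list_of_strict_mono_image:
  fixes \<sigma> :: "nat \<Rightarrow> 'b::linorder"
  assumes "strict_mono \<sigma>"
  shows "sorted_list_of_set (\<sigma> ` {a..<b}) = map \<sigma> [a..<b]"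
proof -
  have "sorted (map \<sigma> [a..<b])"
    using assms by (auto simp: sorted_iff_nth_mono strict_mono_less_eq)
  moreover have "distinct (map \<sigma> [a..<b])"
    using strict_mono_imp_inj_on[OF assms] by (simp add: distinct_map inj_on_subset)
  ultimately show ?thesis
    using sorted_list_of_set.idem_if_sorted_distinct[of "map \<sigma> [a..<b]"] by simp
qed

text \<open>Once \<open>s\<close> and \<open>t\<close> are located between consecutive members of the sequence, the impulses
  between them are those with consecutive indices, so that induction on their number becomes
  possible.\<close>

lemma propagator_window:
  assumes \<sigma>: "\<sigma> \<in> impulse_seqs"
    and s: "\<sigma> k \<le> s" "s < \<sigma> (Suc k)" and t: "\<sigma> (k + n) \<le> t" "t < \<sigma> (Suc (k + n))"
  shows "propagator S J \<sigma> t s = evolve S J (map \<sigma> [Suc k..<Suc (k + n)]) t s"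
    and "impulse_count \<sigma> t s = n"
proof -
  have mono: "strict_mono \<sigma>" using \<sigma> by (rule impulse_seqs_strict_mono)
  have "impulse_times \<sigma> \<inter> {s<..t} = \<sigma> ` {Suc k..<Suc (k + n)}"
  proof (intro set_eqI iffI)
    fix r assume "r \<in> impulse_times \<sigma> \<inter> {s<..t}"
    then obtain i where i: "r = \<sigma> i" "s < \<sigma> i" "\<sigma> i \<le> t" by (auto simp: impulse_times_def)
    have "\<sigma> k < \<sigma> i" "\<sigma> i < \<sigma> (Suc (k + n))" using i s t by linarith+
    then have "k < i" "i < Suc (k + n)" using mono by (simp_all add: strict_mono_less)
    then show "r \<in> \<sigma> ` {Suc k..<Suc (k + n)}" using i by auto
  next
    fix r assume "r \<in> \<sigma> ` {Suc k..<Suc (k + n)}"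
    then obtain i where i: "r = \<sigma> i" "Suc k \<le> i" "i \<le> k + n" by auto
    have "\<sigma> (Suc k) \<le> \<sigma> i" "\<sigma> i \<le> \<sigma> (k + n)" using i mono by (simp_all add: strict_mono_less_eq)
    then show "r \<in> impulse_times \<sigma> \<inter> {s<..t}" using i s t by (auto simp: impulse_times_def)
  qed
  moreover have "card (\<sigma> ` {Suc k..<Suc (k + n)}) = n"
    using strict_mono_imp_inj_on[OF mono] by (subst card_image) (auto intro: inj_on_subset)
  ultimately show "propagator S J \<sigma> t s = evolve S J (map \<sigma> [Suc k..<Suc (k + n)]) t s"
    and "impulse_count \<sigma> t s = n"
    by (simp_all only: propagator_def impulse_count_def sorted_list_of_strict_mono_image[OF mono])
qed

text \<open>Starting at an impulse time, only complete gaps precede the last impulse, so the evolution is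
  a jump product up to the final piece without impulses.\<close>

lemma evolve_from_impulse:
  "evolve S J (map \<sigma> [Suc k..<Suc (k + n)]) t (\<sigma> k) =
     S (t - \<sigma> (k + n)) o\<^sub>L jump_product S J (map (\<lambda>i. \<sigma> (Suc i) - \<sigma> i) [k..<k + n])"
proof (induction n arbitrary: k)
  case 0
  then show ?case by (auto intro: blinfun_eqI simp del: upt_Suc)
next
  case (Suc n)
  have "[Suc k..<Suc (k + Suc n)] = Suc k # [Suc (Suc k)..<Suc (Suc k + n)]"
    and "[k..<k + Suc n] = k # [Suc k..<Suc k + n]"
    by (simp_all add: upt_rec)
  then show ?case using Suc[of "Suc k"]
    by (auto intro!: blinfun_eqI simp del: upt_Suc)
qed

lemma seqs_rng_growth:
  assumes "\<sigma> \<in> seqs_rng Tmin Tmax"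
  shows "\<sigma> (k + n) - \<sigma> k \<le> real n * Tmax"
proof (induction n)
  case (Suc n)
  have "\<sigma> (Suc (k + n)) - \<sigma> (k + n) \<le> Tmax" using assms by (simp add: seqs_rng_def)
  with Suc show ?case by (simp add: algebra_simps)
qed simp

lemma partial_sums_in_seqs_rng:
  fixes d :: "nat \<Rightarrow> real"
  assumes "0 < Tmin" and d: "\<And>i. d i \<in> {Tmin..Tmax}"
  shows "(\<lambda>k. \<Sum>i<k. d i) \<in> seqs_rng Tmin Tmax"
proof -
  have "filterlim (\<lambda>k. \<Sum>i<k. d i) at_top sequentially"
  proof (rule filterlim_at_top_mono)
    show "filterlim (\<lambda>k. real k * Tmin) at_top sequentially"
      using \<open>0 < Tmin\<close>
      by (intro filterlim_at_top_mult_tendsto_pos[OF tendsto_const] filterlim_real_sequentially)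
    have "real k * Tmin \<le> (\<Sum>i<k. d i)" for k
      using sum_bounded_below[of "{..<k}" Tmin d] d by auto
    then show "\<forall>\<^sub>F k in sequentially. real k * Tmin \<le> (\<Sum>i<k. d i)" by simp
  qed
  moreover have "0 < d i" for i using d[of i] \<open>0 < Tmin\<close> by auto
  ultimately show ?thesis using d by (auto simp: seqs_rng_def impulse_seqs_def)
qed

lemma UGES_imp_product_decay:
  assumes C0: "C0_semigroup S" and "0 < Tmin" "Tmin \<le> Tmax"
    and UGES: "strongly_UGES S J (seqs_rng Tmin Tmax)"
  obtains C \<nu> where "product_decay S J {Tmin..Tmax} C \<nu>"
proof -
  obtain M \<alpha> \<rho> where M: "M \<ge> 1" "\<alpha> > 0" "0 < \<rho>" "\<rho> < 1" and
    bound: "\<And>\<sigma> s t. \<lbrakk>\<sigma> \<in> seqs_rng Tmin Tmax; 0 \<le> s; s \<le> t\<rbrakk> \<Longrightarrow>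
      norm (propagator S J \<sigma> t s) \<le> M * \<rho> ^ impulse_count \<sigma> t s * exp (- \<alpha> * (t - s))"
    using UGES unfolding strongly_UGES_def by blast
  have "norm (jump_product S J \<theta>s) \<le> M * \<rho> ^ length \<theta>s" if \<theta>s: "set \<theta>s \<subseteq> {Tmin..Tmax}" for \<theta>s
  proof -
    define n where "n = length \<theta>s"
    \<comment> \<open>A sequence whose first gaps are \<open>\<theta>s\<close>, continued in an arbitrary admissible way.\<close>
    define \<sigma> where "\<sigma> = (\<lambda>k. \<Sum>i<k. if i < n then \<theta>s ! i else Tmax)"
    have mem: "(if i < n then \<theta>s ! i else Tmax) \<in> {Tmin..Tmax}" for i
      using subsetD[OF \<theta>s nth_mem, of i] \<open>Tmin \<le> Tmax\<close> unfolding n_def by auto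
    have \<sigma>: "\<sigma> \<in> seqs_rng Tmin Tmax"
      unfolding \<sigma>_def using \<open>0 < Tmin\<close> mem by (rule partial_sums_in_seqs_rng)
    then have \<sigma>': "\<sigma> \<in> impulse_seqs" by (simp add: seqs_rng_def)
    then have mono: "strict_mono \<sigma>" by (rule impulse_seqs_strict_mono)
    have \<sigma>0: "\<sigma> 0 = 0" by (simp add: \<sigma>_def)
    have "map (\<lambda>i. \<sigma> (Suc i) - \<sigma> i) [0..<n] = \<theta>s"
      by (rule nth_equalityI) (auto simp: n_def \<sigma>_def)
    then have "evolve S J (map \<sigma> [Suc 0..<Suc (0 + n)]) (\<sigma> n) (\<sigma> 0) = jump_product S J \<theta>s"
      using C0 evolve_from_impulse[of S J \<sigma> 0 n "\<sigma> n"]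
      by (auto simp: C0_semigroup_def intro!: blinfun_eqI simp del: upt_Suc)
    moreover have "\<sigma> 0 < \<sigma> (Suc 0)" "\<sigma> n < \<sigma> (Suc n)" "\<sigma> 0 \<le> \<sigma> n"
      using mono by (simp_all add: strict_mono_less strict_mono_less_eq)
    ultimately have "propagator S J \<sigma> (\<sigma> n) 0 = jump_product S J \<theta>s"
      and "impulse_count \<sigma> (\<sigma> n) 0 = n" and n0: "0 \<le> \<sigma> n"
      using propagator_window(1)[OF \<sigma>', of 0 "\<sigma> 0" n "\<sigma> n" S J]
        propagator_window(2)[OF \<sigma>', of 0 "\<sigma> 0" n "\<sigma> n"] \<sigma>0
      by (simp_all del: upt_Suc)
    then have "norm (jump_product S J \<theta>s) \<le> M * \<rho> ^ n * exp (- \<alpha> * (\<sigma> n - 0))"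
      using bound[OF \<sigma>, of 0 "\<sigma> n"] by simp
    also have "\<dots> \<le> M * \<rho> ^ n * 1"
      using M n0 by (intro mult_left_mono) auto
    finally show ?thesis by (simp add: n_def)
  qed
  then show ?thesis using M by (intro that[of M \<rho>]) (simp add: product_decay_def)
qed

text \<open>Along the sequence with constant gap \<open>Tmax\<close> no impulse occurs before \<open>Tmax\<close>, so the
  propagator from 0 is the semigroup itself and \<open>g\<close> bounds it on \<open>[0, Tmax)\<close>. The endpoint
  \<open>Tmax\<close>, where \<open>g\<close> need not be controlled, is reached by the semigroup law from \<open>Tmax / 2\<close>.\<close>

lemma growth_condition_imp_bounded:
  assumes C0: "C0_semigroup S" and "0 < Tmin" "Tmin \<le> Tmax"
    and growth: "growth_condition S J Tmin Tmax"
  obtains B where "1 \<le> B" and "\<And>t. t \<in> {0..Tmax} \<Longrightarrow> norm (S t) \<le> B"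
proof -
  obtain g \<mu>\<^sub>0 where g: "\<And>\<sigma> s t x. \<lbrakk>\<sigma> \<in> seqs_rng Tmin Tmax; 0 \<le> s; s \<le> t\<rbrakk> \<Longrightarrow>
      norm (propagator S J \<sigma> t s x) \<le> g (t - s) * \<mu>\<^sub>0 ^ impulse_count \<sigma> t s * norm x"
    and "bdd_above (g ` {0..<Tmax})"
    using growth unfolding growth_condition_def by blast
  then obtain G where G: "\<And>t. t \<in> {0..<Tmax} \<Longrightarrow> g t \<le> G" unfolding bdd_above_def by blast
  define B where "B = max 1 G"
  have B: "1 \<le> B" by (simp add: B_def)
  define \<sigma> where "\<sigma> = (\<lambda>k::nat. \<Sum>i<k. Tmax)"
  have \<sigma>: "\<sigma> \<in> seqs_rng Tmin Tmax"
    unfolding \<sigma>_def using assms by (intro partial_sums_in_seqs_rng) auto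
  have St: "norm (S t) \<le> B" if t: "t \<in> {0..<Tmax}" for t
  proof (rule norm_blinfun_bound)
    fix x
    have "propagator S J \<sigma> t 0 = S t" "impulse_count \<sigma> t 0 = 0"
      using propagator_window(1)[of \<sigma> 0 0 0 t S J] propagator_window(2)[of \<sigma> 0 0 0 t] \<sigma> t
      by (auto simp: seqs_rng_def \<sigma>_def)
    then have "norm (S t x) \<le> g t * norm x" using g[OF \<sigma>, of 0 t x] t by simp
    also have "\<dots> \<le> B * norm x"
      using G[OF t] by (intro mult_right_mono) (auto simp: B_def)
    finally show "norm (S t x) \<le> B * norm x" .
  qed (use B in simp)
  have "norm (S t) \<le> B * B" if t: "t \<in> {0..Tmax}" for t
  proof -
    have half: "t / 2 \<in> {0..<Tmax}" using t assms by auto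
    then have "S t = S (t / 2) o\<^sub>L S (t / 2)"
      using C0 by (metis C0_semigroup_def atLeastLessThan_iff field_sum_of_halves)
    then have "norm (S t) \<le> norm (S (t / 2)) * norm (S (t / 2))"
      by (simp add: norm_blinfun_compose)
    also have "\<dots> \<le> B * B" using St[OF half] B by (intro mult_mono) auto
    finally show ?thesis .
  qed
  moreover have "1 \<le> B * B" using B by (simp add: mult_ge1_I)
  ultimately show ?thesis by (intro that[of "B * B"])
qed

section \<open>The impulsive flow\<close>

locale impulsive_flow =
  fixes S :: "real \<Rightarrow> 'a::banach \<Rightarrow>\<^sub>L 'a"
    and J :: "'a \<Rightarrow>\<^sub>L 'a"
    and Tmin Tmax B :: real
  assumes C0: "C0_semigroup S"
    and Tmin_pos: "0 < Tmin" and Tmin_le_Tmax: "Tmin \<le> Tmax"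
    and B_ge_1: "1 \<le> B"
    and norm_S_le: "\<And>t. t \<in> {0..Tmax} \<Longrightarrow> norm (S t) \<le> B"
begin

lemma S_0: "S 0 = id_blinfun"
  using C0 by (simp add: C0_semigroup_def)

lemma S_add: "\<lbrakk>0 \<le> s; 0 \<le> t\<rbrakk> \<Longrightarrow> S (s + t) x = S s (S t x)"
  using C0 by (simp add: C0_semigroup_def)

lemma norm_S_apply_le: "t \<in> {0..Tmax} \<Longrightarrow> norm (S t x) \<le> B * norm x"
  by (rule order_trans[OF norm_blinfun]) (simp add: norm_S_le mult_right_mono)

text \<open>For \<open>s < t\<close> the difference \<open>S t x - S s x\<close> is \<open>S s\<close> applied to \<open>S (t - s) x - x\<close>, so right
  continuity at 0 and the bound \<open>B\<close> give a modulus of continuity on the whole interval.\<close>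

lemma orbit_uniformly_continuous:
  assumes "e > 0"
  obtains d where "d > 0" and
    "\<And>s t. \<lbrakk>s \<in> {0..Tmax}; t \<in> {0..Tmax}; \<bar>s - t\<bar> < d\<rbrakk> \<Longrightarrow> norm (S s x - S t x) < e"
proof -
  have "((\<lambda>h. S h x) \<longlongrightarrow> x) (at_right 0)" using C0 by (simp add: C0_semigroup_def)
  then have "\<forall>\<^sub>F h in at_right 0. dist (S h x) x < e / B"
    using \<open>e > 0\<close> B_ge_1 by (intro tendstoD) simp_all
  then obtain d where d: "d > 0" "\<And>h. \<lbrakk>0 < h; h < d\<rbrakk> \<Longrightarrow> dist (S h x) x < e / B"
    by (auto simp: eventually_at_right_field)
  have mono: "norm (S t x - S s x) < e"
    if "s \<in> {0..Tmax}" "t \<in> {0..Tmax}" "s < t" "t - s < d" for s t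
  proof -
    have "S t x - S s x = S s (S (t - s) x - x)"
      using S_add[of s "t - s" x] that by (simp add: blinfun.diff_right)
    then have "norm (S t x - S s x) \<le> B * norm (S (t - s) x - x)"
      using norm_S_apply_le[OF that(1)] by simp
    also have "\<dots> < B * (e / B)"
      using d(2)[of "t - s"] that B_ge_1 by (intro mult_strict_left_mono) (auto simp: dist_norm)
    also have "\<dots> = e" using B_ge_1 by simp
    finally show ?thesis .
  qed
  show ?thesis
  proof (rule that[OF d(1)])
    fix s t assume "s \<in> {0..Tmax}" "t \<in> {0..Tmax}" "\<bar>s - t\<bar> < d"
    then show "norm (S s x - S t x) < e"
      using mono[of s t] mono[of t s] \<open>e > 0\<close>
      by (cases s t rule: linorder_cases) (auto simp: norm_minus_commute)
  qed
qed

text \<open>The orbit stays in the ball of radius \<open>B \<parallel>x\<parallel> + 1\<close>, where the Lipschitz constant does not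
  depend on the clock; hence separate continuity in the clock is enough.\<close>

lemma continuous_on_along_orbit:
  assumes lip: "lipschitz_on_bounded_unif {0..Tmax} V"
    and cont: "\<And>x. continuous_on {0..Tmax} (\<lambda>\<tau>. V \<tau> x)"
  shows "continuous_on {0..Tmax} (\<lambda>\<tau>. V \<tau> (S \<tau> x))"
  unfolding continuous_on_def
proof
  fix t assume t: "t \<in> {0..Tmax}"
  have orbit: "((\<lambda>\<tau>. S \<tau> x) \<longlongrightarrow> S t x) (at t within {0..Tmax})"
  proof (rule tendstoI)
    fix e :: real assume "e > 0"
    then obtain d where "d > 0" and
      "\<And>s t. \<lbrakk>s \<in> {0..Tmax}; t \<in> {0..Tmax}; \<bar>s - t\<bar> < d\<rbrakk> \<Longrightarrow> norm (S s x - S t x) < e"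
      using orbit_uniformly_continuous[of e x] by blast
    then show "\<forall>\<^sub>F \<tau> in at t within {0..Tmax}. dist (S \<tau> x) (S t x) < e"
      using t unfolding eventually_at by (auto simp: dist_norm intro!: exI[of _ d])
  qed
  have "B * norm x + 1 > 0" using B_ge_1 by (intro add_nonneg_pos) auto
  with lip obtain L where "\<forall>\<tau>\<in>{0..Tmax}. \<forall>u v. norm u < B * norm x + 1 \<and> norm v < B * norm x + 1 \<longrightarrow>
      \<bar>V \<tau> u - V \<tau> v\<bar> \<le> L * norm (u - v)"
    unfolding lipschitz_on_bounded_unif_def by blast
  then have L: "\<bar>V \<tau> u - V \<tau> v\<bar> \<le> L * norm (u - v)"
    if "\<tau> \<in> {0..Tmax}" "norm u < B * norm x + 1" "norm v < B * norm x + 1" for \<tau> u v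
    using that by blast
  have "((\<lambda>\<tau>. V \<tau> (S \<tau> x) - V \<tau> (S t x)) \<longlongrightarrow> 0) (at t within {0..Tmax})"
  proof (rule Lim_null_comparison)
    show "\<forall>\<^sub>F \<tau> in at t within {0..Tmax}.
        norm (V \<tau> (S \<tau> x) - V \<tau> (S t x)) \<le> L * norm (S \<tau> x - S t x)"
      unfolding eventually_at_filter
    proof (intro always_eventually allI impI)
      fix \<tau> assume \<tau>: "\<tau> \<in> {0..Tmax}"
      have "norm (S \<tau> x) < B * norm x + 1" "norm (S t x) < B * norm x + 1"
        using norm_S_apply_le[OF \<tau>, of x] norm_S_apply_le[OF t, of x] by linarith+
      then show "norm (V \<tau> (S \<tau> x) - V \<tau> (S t x)) \<le> L * norm (S \<tau> x - S t x)"
        using L[OF \<tau>] by simp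
    qed
    show "((\<lambda>\<tau>. L * norm (S \<tau> x - S t x)) \<longlongrightarrow> 0) (at t within {0..Tmax})"
      using orbit by (intro tendsto_mult_right_zero tendsto_norm_zero) (simp add: LIM_zero)
  qed
  moreover have "((\<lambda>\<tau>. V \<tau> (S t x)) \<longlongrightarrow> V t (S t x)) (at t within {0..Tmax})"
    using cont t by (simp add: continuous_on_def)
  ultimately show "((\<lambda>\<tau>. V \<tau> (S \<tau> x)) \<longlongrightarrow> V t (S t x)) (at t within {0..Tmax})"
    by (rule Lim_transform[rotated])
qed

section \<open>Decay of the jump products implies exponential stability\<close>

text \<open>With \<open>n \<ge> 1\<close> impulses the propagator is a product of \<open>n - 1\<close> complete gaps, preceded by the
  piece up to the first impulse and followed by the piece after the last one. Each of the two
  pieces costs a factor \<open>B\<close>; the impulse missing in the product costs \<open>norm J / \<nu>\<close>. The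
  summand \<open>B\<close> in the constant serves the case without impulses.\<close>

lemma product_decay_imp_propagator_bound:
  assumes decay: "product_decay S J {Tmin..Tmax} C \<nu>"
    and \<sigma>: "\<sigma> \<in> seqs_rng Tmin Tmax" and "0 \<le> s" "s \<le> t"
  obtains n where "impulse_count \<sigma> t s = n" and "t - s \<le> real (Suc n) * Tmax"
    and "norm (propagator S J \<sigma> t s) \<le> (B + B * C * norm J * B / \<nu>) * \<nu> ^ n"
proof -
  have C: "1 \<le> C" "0 < \<nu>" "\<nu> < 1" and
    prod: "\<And>\<theta>s. set \<theta>s \<subseteq> {Tmin..Tmax} \<Longrightarrow> norm (jump_product S J \<theta>s) \<le> C * \<nu> ^ length \<theta>s"
    using decay by (auto simp: product_decay_def)
  have \<sigma>': "\<sigma> \<in> impulse_seqs" and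
    gap: "\<And>i. \<sigma> (Suc i) - \<sigma> i \<in> {Tmin..Tmax}" using \<sigma> by (auto simp: seqs_rng_def)
  have mono: "strict_mono \<sigma>" using \<sigma>' by (rule impulse_seqs_strict_mono)
  obtain k where k: "\<sigma> k \<le> s" "s < \<sigma> (Suc k)" using impulse_bracket[OF \<sigma>' \<open>0 \<le> s\<close>] .
  obtain m where m: "\<sigma> m \<le> t" "t < \<sigma> (Suc m)"
    using impulse_bracket[OF \<sigma>'] \<open>0 \<le> s\<close> \<open>s \<le> t\<close> order_trans by metis
  have "\<sigma> k < \<sigma> (Suc m)" using k m \<open>s \<le> t\<close> by linarith
  then have "k \<le> m" using mono by (simp add: strict_mono_less)
  then obtain n where n: "m = k + n" by (auto simp: le_iff_add)
  note window = propagator_window[OF \<sigma>' k m[unfolded n]]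
  have len: "t - s \<le> real (Suc n) * Tmax"
    using seqs_rng_growth[OF \<sigma>, of k "Suc n"] k m n by simp
  have "norm (propagator S J \<sigma> t s) \<le> (B + B * C * norm J * B / \<nu>) * \<nu> ^ n"
  proof (cases n)
    case 0
    have "norm (S (t - s)) \<le> B"
      using len \<open>s \<le> t\<close> 0 by (intro norm_S_le) auto
    also have "B \<le> B + B * C * norm J * B / \<nu>" using B_ge_1 C by simp
    finally show ?thesis using window(1)[of S J] 0 by simp
  next
    case (Suc n')
    define P where "P = jump_product S J (map (\<lambda>i. \<sigma> (Suc i) - \<sigma> i) [Suc k..<Suc k + n'])"
    have "[Suc k..<Suc (k + n)] = Suc k # [Suc (Suc k)..<Suc (Suc k + n')]"
      using Suc by (simp add: upt_rec)
    then have eq: "propagator S J \<sigma> t s =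
        (S (t - \<sigma> (k + n)) o\<^sub>L P) o\<^sub>L (J o\<^sub>L S (\<sigma> (Suc k) - s))"
      using window(1)[of S J] evolve_from_impulse[of S J \<sigma> "Suc k" n' t] Suc
      by (simp add: P_def del: upt_Suc)
    have "norm P \<le> C * \<nu> ^ n'"
      using prod[of "map (\<lambda>i. \<sigma> (Suc i) - \<sigma> i) [Suc k..<Suc k + n']"] gap
      by (simp add: P_def image_subset_iff del: upt_Suc)
    moreover have "norm (S (t - \<sigma> (k + n))) \<le> B"
      using gap[of m] m n by (intro norm_S_le) auto
    moreover have "norm (S (\<sigma> (Suc k) - s)) \<le> B"
      using gap[of k] k by (intro norm_S_le) auto
    ultimately have "norm (propagator S J \<sigma> t s) \<le> (B * (C * \<nu> ^ n')) * (norm J * B)"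
      unfolding eq using B_ge_1 C
      by (intro order_trans[OF norm_blinfun_compose] mult_mono) auto
    also have "\<dots> = B * C * norm J * B / \<nu> * \<nu> ^ n" using C Suc by simp
    also have "\<dots> \<le> (B + B * C * norm J * B / \<nu>) * \<nu> ^ n"
      using B_ge_1 C by (intro mult_right_mono) auto
    finally show ?thesis .
  qed
  then show ?thesis using window(2) len by (intro that[of n])
qed

text \<open>Writing \<open>\<nu> = \<rho>\<^sup>2\<close>, one factor \<open>\<rho>\<^sup>n\<close> remains as the decay per impulse, and the other one is
  turned into decay in time by \<open>t - s \<le> (n + 1) Tmax\<close>.\<close>

lemma product_decay_imp_UGES:
  assumes decay: "product_decay S J {Tmin..Tmax} C \<nu>"
  shows "strongly_UGES S J (seqs_rng Tmin Tmax)"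
proof -
  define K where "K = B + B * C * norm J * B / \<nu>"
  define \<rho> where "\<rho> = sqrt \<nu>"
  define \<alpha> where "\<alpha> = - ln \<rho> / Tmax"
  have C: "1 \<le> C" "0 < \<nu>" "\<nu> < 1" using decay by (auto simp: product_decay_def)
  have \<rho>: "0 < \<rho>" "\<rho> < 1" "\<nu> = \<rho> * \<rho>" using C by (simp_all add: \<rho>_def)
  have Tmax: "0 < Tmax" using Tmin_pos Tmin_le_Tmax by simp
  have K: "1 \<le> K" unfolding K_def using B_ge_1 C by (simp add: add_increasing2)
  have \<alpha>: "0 < \<alpha>" unfolding \<alpha>_def using \<rho> Tmax by (intro divide_pos_pos) auto
  have "norm (propagator S J \<sigma> t s) \<le> K / \<rho> * \<rho> ^ impulse_count \<sigma> t s * exp (- \<alpha> * (t - s))"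
    if \<sigma>: "\<sigma> \<in> seqs_rng Tmin Tmax" and st: "0 \<le> s" "s \<le> t" for \<sigma> s t
  proof -
    obtain n where n: "impulse_count \<sigma> t s = n" "t - s \<le> real (Suc n) * Tmax"
      and bound: "norm (propagator S J \<sigma> t s) \<le> K * \<nu> ^ n"
      unfolding K_def using product_decay_imp_propagator_bound[OF decay \<sigma> st] .
    have "\<rho> ^ Suc n = exp (real (Suc n) * ln \<rho>)"
      using \<rho>(1) by (metis exp_ln exp_of_nat_mult)
    also have "real (Suc n) * ln \<rho> = - \<alpha> * (real (Suc n) * Tmax)" using Tmax by (simp add: \<alpha>_def)
    also have "exp \<dots> \<le> exp (- \<alpha> * (t - s))"
      using n(2) \<alpha> by simp
    finally have "\<rho> ^ n \<le> exp (- \<alpha> * (t - s)) / \<rho>" using \<rho> by (simp add: field_simps)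
    then have "K * \<rho> ^ n * \<rho> ^ n \<le> K * \<rho> ^ n * (exp (- \<alpha> * (t - s)) / \<rho>)"
      using K \<rho> by (intro mult_left_mono) auto
    then show ?thesis using bound n(1) \<rho>(3) by (simp add: power_mult_distrib mult.assoc)
  qed
  moreover have "1 \<le> K / \<rho>" using K \<rho> by (simp add: field_simps)
  ultimately show ?thesis unfolding strongly_UGES_def using \<alpha> \<rho> by blast
qed

section \<open>Discrete Lyapunov functions\<close>

abbreviation jump_family :: "('a \<Rightarrow>\<^sub>L 'a) set" where
  "jump_family \<equiv> {J o\<^sub>L S \<theta> |\<theta>. \<theta> \<in> {Tmin..Tmax}}"

lemma discrete_Lyapunov_imp_product_decay:
  assumes "p \<ge> 1" "c \<ge> 1" "0 < \<mu>" "\<mu> < 1"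
    and V: "uniform_discrete_Lyapunov jump_family p c \<mu> V"
  shows "product_decay S J {Tmin..Tmax} (c powr (1 / p)) (\<mu> powr (1 / p))"
proof -
  have coercive: "norm x powr p \<le> V x" "V x \<le> c * norm x powr p"
    and jump: "\<theta> \<in> {Tmin..Tmax} \<Longrightarrow> V (J (S \<theta> x)) \<le> \<mu> * V x" for x \<theta>
    using V unfolding uniform_discrete_Lyapunov_def by fastforce+
  have V_decay: "V (jump_product S J \<theta>s x) \<le> \<mu> ^ length \<theta>s * V x"
    if "set \<theta>s \<subseteq> {Tmin..Tmax}" for \<theta>s x
    using that
  proof (induction \<theta>s arbitrary: x)
    case (Cons \<theta> \<theta>s)
    have "V (jump_product S J (\<theta> # \<theta>s) x) \<le> \<mu> ^ length \<theta>s * V (J (S \<theta> x))"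
      using Cons by simp
    also have "\<dots> \<le> \<mu> ^ length \<theta>s * (\<mu> * V x)"
      using jump[of \<theta> x] Cons.prems \<open>0 < \<mu>\<close> by (intro mult_left_mono) auto
    finally show ?case by (simp add: mult_ac)
  qed simp
  have "norm (jump_product S J \<theta>s) \<le> c powr (1 / p) * (\<mu> powr (1 / p)) ^ length \<theta>s"
    if \<theta>s: "set \<theta>s \<subseteq> {Tmin..Tmax}" for \<theta>s
  proof (rule norm_blinfun_bound)
    fix x
    have "norm (jump_product S J \<theta>s x) powr p \<le> \<mu> ^ length \<theta>s * V x"
      using coercive(1) V_decay[OF \<theta>s] order_trans by blast
    also have "\<dots> \<le> \<mu> ^ length \<theta>s * (c * norm x powr p)"
      using coercive(2) \<open>0 < \<mu>\<close> by (intro mult_left_mono) auto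
    finally have "(norm (jump_product S J \<theta>s x) powr p) powr (1 / p) \<le>
        (\<mu> ^ length \<theta>s * (c * norm x powr p)) powr (1 / p)"
      using \<open>p \<ge> 1\<close> by (intro powr_mono2) auto
    also have "\<dots> = (\<mu> powr (1 / p)) ^ length \<theta>s * (c powr (1 / p) * norm x)"
      using assms(1-4) by (simp add: powr_mult powr_powr powr_realpow[symmetric] mult.commute)
    finally show "norm (jump_product S J \<theta>s x) \<le>
        c powr (1 / p) * (\<mu> powr (1 / p)) ^ length \<theta>s * norm x"
      using \<open>p \<ge> 1\<close> by (simp add: powr_powr mult.assoc mult.left_commute)
  qed (use assms in simp)
  moreover have "1 \<le> c powr (1 / p)" using assms by (simp add: ge_one_powr_ge_zero)
  moreover have "\<mu> powr (1 / p) < 1" using assms powr_less_mono2[of "1 / p" \<mu> 1] by simp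
  ultimately show ?thesis using \<open>0 < \<mu>\<close> by (simp add: product_decay_def)
qed

text \<open>The supremum of \<open>\<nu>\<^bsup>-n\<^esup> \<parallel>P x\<parallel>\<close> over all jump products \<open>P\<close> of \<open>n\<close> factors. A product applied
  to \<open>J (S \<theta> x)\<close> is a product with one more factor applied to \<open>x\<close>, which gains \<open>\<nu>\<close>.\<close>

lemma product_decay_imp_discrete_Lyapunov:
  assumes decay: "product_decay S J {Tmin..Tmax} C \<nu>"
  obtains V where "uniform_discrete_Lyapunov jump_family 1 C \<nu> V"
proof -
  have C: "1 \<le> C" "0 < \<nu>" "\<nu> < 1" and
    prod: "\<And>\<theta>s. set \<theta>s \<subseteq> {Tmin..Tmax} \<Longrightarrow> norm (jump_product S J \<theta>s) \<le> C * \<nu> ^ length \<theta>s"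
    using decay by (auto simp: product_decay_def)
  define F where "F = {(1 / \<nu> ^ length \<theta>s) *\<^sub>R jump_product S J \<theta>s |\<theta>s. set \<theta>s \<subseteq> {Tmin..Tmax}}"
  have bound: "norm T \<le> C" if "T \<in> F" for T
    using that prod C by (auto simp: F_def divide_simps)
  have id: "id_blinfun \<in> F" unfolding F_def by (force intro: exI[of _ "[]"])
  then have ne: "F \<noteq> {}" by auto
  have lower: "norm x \<le> sup_norm F x" for x
    using sup_norm_upper[OF bound id, of x] by simp
  have jump: "sup_norm F (J (S \<theta> x)) \<le> \<nu> * sup_norm F x" if \<theta>: "\<theta> \<in> {Tmin..Tmax}" for \<theta> x
  proof -
    have "sup_norm F (J (S \<theta> x)) \<le> \<nu> * sup_norm F x + 0"
    proof (rule sup_norm_compare[OF ne bound])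
      fix T assume "T \<in> F"
      then obtain \<theta>s where \<theta>s: "set \<theta>s \<subseteq> {Tmin..Tmax}"
        and T: "T = (1 / \<nu> ^ length \<theta>s) *\<^sub>R jump_product S J \<theta>s" by (auto simp: F_def)
      define U where "U = (1 / \<nu> ^ length (\<theta> # \<theta>s)) *\<^sub>R jump_product S J (\<theta> # \<theta>s)"
      have "U \<in> F" unfolding F_def U_def using \<theta> \<theta>s by (intro CollectI exI[of _ "\<theta> # \<theta>s"]) auto
      moreover have "norm (T (J (S \<theta> x))) = \<nu> * norm (U x)"
        using C by (simp add: T U_def blinfun.scaleR_left)
      ultimately show "\<exists>U\<in>F. norm (T (J (S \<theta> x))) \<le> \<nu> * norm (U x) + 0" by force
    qed (use C in auto)
    then show ?thesis by simp
  qed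
  show ?thesis
  proof (rule that)
    show "uniform_discrete_Lyapunov jump_family 1 C \<nu> (sup_norm F)"
      unfolding uniform_discrete_Lyapunov_def lipschitz_on_bounded_def
      using lower jump sup_norm_least[OF ne bound] sup_norm_lipschitz[OF ne bound] C
      by (auto intro: order_trans[OF norm_ge_zero] exI[of _ C])
  qed
qed

section \<open>Clock-dependent Lyapunov functions\<close>

text \<open>Along \<open>\<tau> \<mapsto> V \<tau> (S \<tau> x)\<close> clock and semigroup advance together, so the difference quotients of
  this function are those in \<open>lower_Dini\<close> at the point \<open>S \<tau> x\<close>, and the comparison principle
  applies up to the next impulse.\<close>

lemma clock_Lyapunov_imp_discrete_Lyapunov:
  assumes "\<eta> \<ge> 0" "0 < \<mu>"
    and V: "clock_Lyapunov S J Tmin Tmax p c \<eta> \<mu> V"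
  shows "uniform_discrete_Lyapunov jump_family p c (\<mu> * exp (- \<eta> * Tmin)) (V 0)"
proof -
  have Tmax: "0 < Tmax" using Tmin_pos Tmin_le_Tmax by simp
  have nonneg: "\<And>\<tau> x. \<tau> \<in> {0..Tmax} \<Longrightarrow> 0 \<le> V \<tau> x"
    and lip: "lipschitz_on_bounded_unif {0..Tmax} V"
    and cont: "\<And>x. continuous_on {0..Tmax} (\<lambda>\<tau>. V \<tau> x)"
    and coercive: "\<And>\<tau> x. \<tau> \<in> {0..Tmax} \<Longrightarrow> norm x powr p \<le> V \<tau> x \<and> V \<tau> x \<le> c * norm x powr p"
    and dini: "\<And>\<tau> x. \<tau> \<in> {0..<Tmax} \<Longrightarrow> lower_Dini S V \<tau> x \<le> ereal (- \<eta> * V \<tau> x)"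
    and jump: "\<And>\<theta> x. \<theta> \<in> {Tmin..Tmax} \<Longrightarrow> V 0 (J x) \<le> \<mu> * V \<theta> x"
    using V unfolding clock_Lyapunov_def by blast+
  have "V 0 (J (S \<theta> x)) \<le> \<mu> * exp (- \<eta> * Tmin) * V 0 x" if \<theta>: "\<theta> \<in> {Tmin..Tmax}" for \<theta> x
  proof -
    have "V \<theta> (S \<theta> x) \<le> exp (- \<eta> * \<theta>) * V 0 (S 0 x)"
    proof (rule lower_Dini_exponential_decay)
      show "continuous_on {0..\<theta>} (\<lambda>\<tau>. V \<tau> (S \<tau> x))"
        using \<theta> by (intro continuous_on_subset[OF continuous_on_along_orbit[OF lip cont]]) auto
      fix t assume t: "t \<in> {0..<\<theta>}"
      have "\<forall>\<^sub>F h in at_right 0. ereal ((V (t + h) (S (t + h) x) - V t (S t x)) / h) =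
          ereal ((V (t + h) (S h (S t x)) - V t (S t x)) / h)"
        unfolding eventually_at_right_field using t
        by (auto simp: add.commute S_add intro!: exI[of _ 1])
      then have "Liminf (at_right 0) (\<lambda>h. ereal ((V (t + h) (S (t + h) x) - V t (S t x)) / h)) =
          lower_Dini S V t (S t x)"
        unfolding lower_Dini_def by (rule Liminf_eq)
      also have "\<dots> \<le> ereal (- \<eta> * V t (S t x))" using t \<theta> by (intro dini) auto
      finally show "Liminf (at_right 0) (\<lambda>h. ereal ((V (t + h) (S (t + h) x) - V t (S t x)) / h))
          \<le> ereal (- \<eta> * V t (S t x))" .
    qed (use \<theta> Tmin_pos Tmax nonneg \<open>\<eta> \<ge> 0\<close> in auto)
    also have "\<dots> \<le> exp (- \<eta> * Tmin) * V 0 x"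
      using \<theta> nonneg[of 0 x] Tmax \<open>\<eta> \<ge> 0\<close> by (auto simp: S_0 intro!: mult_right_mono mult_left_mono)
    finally have "\<mu> * V \<theta> (S \<theta> x) \<le> \<mu> * (exp (- \<eta> * Tmin) * V 0 x)"
      using \<open>0 < \<mu>\<close> by simp
    then show ?thesis using jump[OF \<theta>, of "S \<theta> x"] by simp
  qed
  moreover have "lipschitz_on_bounded (V 0)"
    using lip Tmax unfolding lipschitz_on_bounded_unif_def lipschitz_on_bounded_def
    by (metis atLeastAtMost_iff less_imp_le order_refl)
  ultimately show ?thesis
    using nonneg coercive Tmax unfolding uniform_discrete_Lyapunov_def by auto
qed

text \<open>What the system can do after an impulse: further complete gaps, then a piece of free flow.\<close>

definition tail_family :: "real \<Rightarrow> ('a \<Rightarrow>\<^sub>L 'a) set" where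
  "tail_family \<nu> = {(1 / \<nu> ^ length \<theta>s) *\<^sub>R (S h o\<^sub>L jump_product S J \<theta>s) |h \<theta>s.
     h \<in> {0..Tmax} \<and> set \<theta>s \<subseteq> {Tmin..Tmax}}"

text \<open>What the system can do when the time \<open>\<tau>\<close> has passed since the last impulse: flow at most
  until the clock shows \<open>Tmax\<close>, or flow until an admissible clock reading and undergo an
  impulse there. The first part contains \<open>S 0 = id\<close> for every \<open>\<tau>\<close>, which makes the supremum
  coercive even if \<open>J\<close> is not injective.\<close>

definition clock_family :: "real \<Rightarrow> real \<Rightarrow> ('a \<Rightarrow>\<^sub>L 'a) set" where
  "clock_family \<nu> \<tau> = {S h |h. 0 \<le> h \<and> \<tau> + h \<le> Tmax} \<union>
     {(1 / \<nu>) *\<^sub>R (T o\<^sub>L (J o\<^sub>L S h)) |T h. T \<in> tail_family \<nu> \<and> 0 \<le> h \<and> \<tau> + h \<in> {Tmin..Tmax}}"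

lemma clock_family_cases:
  assumes "T \<in> clock_family \<nu> \<tau>"
  obtains (flow) h where "T = S h" "0 \<le> h" "\<tau> + h \<le> Tmax"
  | (jump) U h where "T = (1 / \<nu>) *\<^sub>R (U o\<^sub>L (J o\<^sub>L S h))" "U \<in> tail_family \<nu>"
      "0 \<le> h" "\<tau> + h \<in> {Tmin..Tmax}"
  using assms unfolding clock_family_def by blast

lemma clock_family_flow: "\<lbrakk>0 \<le> h; \<tau> + h \<le> Tmax\<rbrakk> \<Longrightarrow> S h \<in> clock_family \<nu> \<tau>"
  unfolding clock_family_def by blast

lemma clock_family_jump:
  "\<lbrakk>U \<in> tail_family \<nu>; 0 \<le> h; \<tau> + h \<in> {Tmin..Tmax}\<rbrakk> \<Longrightarrow>
     (1 / \<nu>) *\<^sub>R (U o\<^sub>L (J o\<^sub>L S h)) \<in> clock_family \<nu> \<tau>"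
  unfolding clock_family_def by blast

lemma clock_family_nonempty: "\<tau> \<in> {0..Tmax} \<Longrightarrow> clock_family \<nu> \<tau> \<noteq> {}"
  using clock_family_flow[of 0 \<tau> \<nu>] by auto

text \<open>Right after an impulse, the waiting time until the next one is a complete gap. This makes
  the impulse inequality for the clock-dependent supremum close up.\<close>

lemma clock_family_0_subset: "clock_family \<nu> 0 \<subseteq> tail_family \<nu>"
proof
  fix T assume "T \<in> clock_family \<nu> 0"
  then show "T \<in> tail_family \<nu>"
  proof (cases rule: clock_family_cases)
    case (flow h)
    then show ?thesis unfolding tail_family_def
      by (intro CollectI exI[of _ h] exI[of _ "[]"]) (auto intro: blinfun_eqI)
  next
    case (jump U h)
    then obtain h' \<theta>s where "h' \<in> {0..Tmax}" "set \<theta>s \<subseteq> {Tmin..Tmax}"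
      and "U = (1 / \<nu> ^ length \<theta>s) *\<^sub>R (S h' o\<^sub>L jump_product S J \<theta>s)"
      by (auto simp: tail_family_def)
    then show ?thesis unfolding tail_family_def using jump
      by (intro CollectI exI[of _ h'] exI[of _ "h # \<theta>s"])
        (auto intro!: blinfun_eqI simp: blinfun.scaleR_left)
  qed
qed

text \<open>Flowing for a time \<open>h\<close> and then acting in a way admissible at the advanced clock is admissible
  at the original clock. Hence the supremum does not increase along the flow.\<close>

lemma clock_family_compose_flow:
  assumes "T \<in> clock_family \<nu> (\<tau> + h)" and "0 \<le> h"
  shows "\<exists>U\<in>clock_family \<nu> \<tau>. T (S h x) = U x"
  using assms(1)
proof (cases rule: clock_family_cases)
  case (flow k)
  then have "T (S h x) = S (k + h) x" using S_add \<open>0 \<le> h\<close> by simp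
  then show ?thesis using flow \<open>0 \<le> h\<close> clock_family_flow[of "k + h" \<tau> \<nu>] by (auto simp: algebra_simps)
next
  case (jump U k)
  then have "T (S h x) = ((1 / \<nu>) *\<^sub>R (U o\<^sub>L (J o\<^sub>L S (k + h)))) x"
    using S_add \<open>0 \<le> h\<close> by (simp add: blinfun.scaleR_left)
  moreover have "(1 / \<nu>) *\<^sub>R (U o\<^sub>L (J o\<^sub>L S (k + h))) \<in> clock_family \<nu> \<tau>"
    using jump \<open>0 \<le> h\<close> by (intro clock_family_jump) (auto simp: algebra_simps)
  ultimately show ?thesis by blast
qed

text \<open>The supremum over the clock family. The delicate point is continuity in the clock, since the
  family itself depends on it: a waiting time \<open>h\<close> admissible at the clock reading \<open>a\<close> becomes
  admissible at \<open>b\<close> after a shift by at most \<open>\<bar>a - b\<bar>\<close>, and this changes the value by little,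
  uniformly over the family, because orbits are uniformly continuous and the operators that
  follow the flow are uniformly bounded.\<close>

lemma product_decay_imp_clock_Lyapunov:
  assumes decay: "product_decay S J {Tmin..Tmax} C \<nu>"
  obtains c V where "c \<ge> 1" and "clock_Lyapunov S J Tmin Tmax 1 c 0 \<nu> V"
proof -
  have C: "1 \<le> C" "0 < \<nu>" "\<nu> < 1" and
    prod: "\<And>\<theta>s. set \<theta>s \<subseteq> {Tmin..Tmax} \<Longrightarrow> norm (jump_product S J \<theta>s) \<le> C * \<nu> ^ length \<theta>s"
    using decay by (auto simp: product_decay_def)
  have Tmax: "0 < Tmax" using Tmin_pos Tmin_le_Tmax by simp
  define K where "K = 1 / \<nu> * (B * C * norm J)"
  define c where "c = B + K * B"
  have K: "0 \<le> K" unfolding K_def using B_ge_1 C by simp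
  have c: "1 \<le> c" unfolding c_def using B_ge_1 K by (simp add: add_increasing2)
  have tail_bound: "norm T \<le> B * C" if "T \<in> tail_family \<nu>" for T
  proof -
    obtain h \<theta>s where h: "h \<in> {0..Tmax}" and \<theta>s: "set \<theta>s \<subseteq> {Tmin..Tmax}"
      and T: "T = (1 / \<nu> ^ length \<theta>s) *\<^sub>R (S h o\<^sub>L jump_product S J \<theta>s)"
      using \<open>T \<in> tail_family \<nu>\<close> by (auto simp: tail_family_def)
    have "norm (S h o\<^sub>L jump_product S J \<theta>s) \<le> B * (C * \<nu> ^ length \<theta>s)"
      using norm_S_le[OF h] prod[OF \<theta>s] B_ge_1
      by (intro order_trans[OF norm_blinfun_compose] mult_mono) auto
    then show ?thesis using C by (simp add: T divide_simps)
  qed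
  have jump_bound: "norm ((1 / \<nu>) *\<^sub>R (U (J y))) \<le> K * norm y" if "U \<in> tail_family \<nu>" for U y
  proof -
    have "norm (U (J y)) \<le> norm U * (norm J * norm y)"
      by (intro order_trans[OF norm_blinfun] mult_left_mono norm_blinfun) simp
    also have "\<dots> \<le> (B * C) * (norm J * norm y)"
      using tail_bound[OF that] by (intro mult_right_mono) auto
    finally show ?thesis using C by (simp add: K_def divide_simps mult.assoc)
  qed
  have bound: "norm T \<le> c" if \<tau>: "\<tau> \<in> {0..Tmax}" and T: "T \<in> clock_family \<nu> \<tau>" for T \<tau>
  proof (rule norm_blinfun_bound)
    fix x
    show "norm (T x) \<le> c * norm x"
      using T
    proof (cases rule: clock_family_cases)
      case (flow h)
      then have "norm (T x) \<le> B * norm x" using \<tau> norm_S_apply_le by simp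
      also have "\<dots> \<le> c * norm x" using K B_ge_1 by (intro mult_right_mono) (auto simp: c_def)
      finally show ?thesis .
    next
      case (jump U h)
      have "norm (T x) \<le> K * norm (S h x)"
        using jump_bound[OF jump(2), of "S h x"] jump(1) by (simp add: blinfun.scaleR_left)
      also have "\<dots> \<le> K * (B * norm x)"
        using norm_S_apply_le[of h x] jump \<tau> K by (intro mult_left_mono) auto
      also have "\<dots> \<le> c * norm x"
        using B_ge_1 by (simp add: c_def distrib_right mult.assoc)
      finally show ?thesis .
    qed
  qed (use c in simp)
  define V where "V \<tau> = sup_norm (clock_family \<nu> \<tau>)" for \<tau>
  note ne = clock_family_nonempty
  have lower: "norm x \<le> V \<tau> x" if \<tau>: "\<tau> \<in> {0..Tmax}" for \<tau> x
    using sup_norm_upper[OF bound[OF \<tau>] clock_family_flow[of 0 \<tau> \<nu>], of x] \<tau>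
    by (simp add: V_def S_0)
  have flow_le: "V (\<tau> + h) (S h x) \<le> V \<tau> x" if \<tau>h: "\<tau> \<in> {0..Tmax}" "0 \<le> h" "\<tau> + h \<le> Tmax" for \<tau> h x
  proof -
    have "V (\<tau> + h) (S h x) \<le> 1 * V \<tau> x + 0"
      unfolding V_def
    proof (rule sup_norm_compare[OF ne bound[OF \<tau>h(1)]])
      fix T assume "T \<in> clock_family \<nu> (\<tau> + h)"
      then obtain U where "U \<in> clock_family \<nu> \<tau>" "T (S h x) = U x"
        using clock_family_compose_flow[of T \<nu> \<tau> h x] \<tau>h(2) by blast
      then show "\<exists>U\<in>clock_family \<nu> \<tau>. norm (T (S h x)) \<le> 1 * norm (U x) + 0" by auto
    qed (use \<tau>h in auto)
    then show ?thesis by simp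
  qed
  have jump_le: "V 0 (J x) \<le> \<nu> * V \<theta> x" if \<theta>: "\<theta> \<in> {Tmin..Tmax}" for \<theta> x
  proof -
    have \<theta>': "\<theta> \<in> {0..Tmax}" using \<theta> Tmin_pos by simp
    have "V 0 (J x) \<le> \<nu> * V \<theta> x + 0"
      unfolding V_def
    proof (rule sup_norm_compare[OF ne bound[OF \<theta>']])
      fix T assume "T \<in> clock_family \<nu> 0"
      then have "T \<in> tail_family \<nu>" using clock_family_0_subset by blast
      then have "(1 / \<nu>) *\<^sub>R (T o\<^sub>L (J o\<^sub>L S 0)) \<in> clock_family \<nu> \<theta>"
        using \<theta> by (intro clock_family_jump) auto
      moreover have "norm (T (J x)) = \<nu> * norm (((1 / \<nu>) *\<^sub>R (T o\<^sub>L (J o\<^sub>L S 0))) x)"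
        using C by (simp add: blinfun.scaleR_left S_0)
      ultimately show "\<exists>U\<in>clock_family \<nu> \<theta>. norm (T (J x)) \<le> \<nu> * norm (U x) + 0"
        by (metis add.right_neutral order_refl)
    qed (use C Tmax in auto)
    then show ?thesis by simp
  qed
  have dini: "lower_Dini S V \<tau> x \<le> 0" if \<tau>: "\<tau> \<in> {0..<Tmax}" for \<tau> x
  proof -
    have "\<forall>\<^sub>F h in at_right 0. ereal ((V (\<tau> + h) (S h x) - V \<tau> x) / h) \<le> 0"
      unfolding eventually_at_right_field using \<tau> flow_le[of \<tau> _ x]
      by (auto intro!: exI[of _ "Tmax - \<tau>"] divide_nonpos_pos)
    then have "lower_Dini S V \<tau> x \<le> Liminf (at_right (0::real)) (\<lambda>_. 0)"
      unfolding lower_Dini_def by (rule Liminf_mono)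
    then show ?thesis by (simp add: Liminf_const)
  qed
  have cont: "continuous_on {0..Tmax} (\<lambda>\<tau>. V \<tau> x)" for x
    unfolding continuous_on_iff
  proof (intro ballI allI impI)
    fix \<tau> e :: real assume \<tau>: "\<tau> \<in> {0..Tmax}" and "e > 0"
    \<comment> \<open>Small enough for a change of the state both on its own and after amplification by \<open>K\<close>.\<close>
    define e' where "e' = e / (2 * (1 + K))"
    have e': "e' > 0" "e' \<le> e / 2" "K * e' \<le> e / 2"
      using K \<open>e > 0\<close> by (simp_all add: e'_def divide_simps algebra_simps)
    obtain d where "d > 0" and d: "\<And>s t. \<lbrakk>s \<in> {0..Tmax}; t \<in> {0..Tmax}; \<bar>s - t\<bar> < d\<rbrakk> \<Longrightarrow>
        norm (S s x - S t x) < e'"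
      using orbit_uniformly_continuous[OF e'(1)] by blast
    have close: "V a x \<le> V b x + e / 2"
      if a: "a \<in> {0..Tmax}" and b: "b \<in> {0..Tmax}" and ab: "\<bar>a - b\<bar> < d" for a b
    proof -
      have "V a x \<le> 1 * V b x + e / 2"
        unfolding V_def
      proof (rule sup_norm_compare[OF ne[OF a] bound[OF b]])
        fix T assume "T \<in> clock_family \<nu> a"
        then show "\<exists>U\<in>clock_family \<nu> b. norm (T x) \<le> 1 * norm (U x) + e / 2"
        proof (cases rule: clock_family_cases)
          case (flow h)
          define h' where "h' = min h (Tmax - b)"
          have h': "0 \<le> h'" "b + h' \<le> Tmax" "\<bar>h - h'\<bar> < d"
            using flow a b ab by (auto simp: h'_def min_def)
          then have "norm (S h x - S h' x) < e'" using a b flow by (intro d) auto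
          then have "norm (T x) \<le> norm (S h' x) + e / 2"
            using norm_triangle_sub[of "S h x" "S h' x"] e' flow(1) by simp
          then show ?thesis using clock_family_flow[of h' b \<nu>] h' by auto
        next
          case (jump U h)
          \<comment> \<open>The waiting time nearest to \<open>h\<close> that is admissible at the clock reading \<open>b\<close>.\<close>
          define h' where "h' = max 0 (max (Tmin - b) (min h (Tmax - b)))"
          have h': "0 \<le> h'" "b + h' \<in> {Tmin..Tmax}" "\<bar>h - h'\<bar> < d"
            using jump a b ab Tmin_le_Tmax by (auto simp: h'_def min_def max_def)
          define U' where "U' = (1 / \<nu>) *\<^sub>R (U o\<^sub>L (J o\<^sub>L S h'))"
          have "norm (S h x - S h' x) < e'" using a b h' jump by (intro d) auto
          then have "K * norm (S h x - S h' x) \<le> e / 2"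
            using K e'(3) by (meson less_imp_le mult_left_mono order_trans)
          moreover have "T x - U' x = (1 / \<nu>) *\<^sub>R (U (J (S h x - S h' x)))"
            by (simp add: jump(1) U'_def blinfun.scaleR_left blinfun.diff_right scaleR_diff_right)
          ultimately have "norm (T x) \<le> norm (U' x) + e / 2"
            using norm_triangle_sub[of "T x" "U' x"] jump_bound[OF jump(2), of "S h x - S h' x"] by simp
          moreover have "U' \<in> clock_family \<nu> b"
            unfolding U'_def using jump(2) h' by (intro clock_family_jump) auto
          ultimately show ?thesis by auto
        qed
      qed simp_all
      then show ?thesis by simp
    qed
    show "\<exists>d>0. \<forall>\<tau>'\<in>{0..Tmax}. dist \<tau>' \<tau> < d \<longrightarrow> dist (V \<tau>' x) (V \<tau> x) < e"
    proof (intro exI[of _ d] conjI ballI impI)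
      fix \<tau>' assume \<tau>': "\<tau>' \<in> {0..Tmax}" "dist \<tau>' \<tau> < d"
      have "V \<tau>' x \<le> V \<tau> x + e / 2" "V \<tau> x \<le> V \<tau>' x + e / 2"
        using \<tau> \<tau>' by (auto intro!: close simp: dist_real_def abs_minus_commute)
      then show "dist (V \<tau>' x) (V \<tau> x) < e"
        using \<open>e > 0\<close> unfolding dist_real_def by linarith
    qed (rule \<open>d > 0\<close>)
  qed
  have lip: "lipschitz_on_bounded_unif {0..Tmax} V"
    unfolding lipschitz_on_bounded_unif_def V_def
    using sup_norm_lipschitz[OF ne bound] c by (auto intro!: exI[of _ c])
  have upper: "V \<tau> x \<le> c * norm x" if "\<tau> \<in> {0..Tmax}" for \<tau> x
    unfolding V_def using that by (intro sup_norm_least[OF ne bound])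
  have nonneg: "0 \<le> V \<tau> x" if "\<tau> \<in> {0..Tmax}" for \<tau> x
    using lower[OF that, of x] norm_ge_zero order_trans by blast
  show ?thesis
  proof (rule that[OF c])
    show "clock_Lyapunov S J Tmin Tmax 1 c 0 \<nu> V"
      unfolding clock_Lyapunov_def
      using nonneg lip cont lower upper dini jump_le by (auto simp: zero_ereal_def)
  qed
qed

end

theorem theorem5p5:
  fixes S :: "real \<Rightarrow> 'a::banach \<Rightarrow>\<^sub>L 'a"
    and D :: "'a set"
    and A :: "'a \<Rightarrow> 'a"
    and J :: "'a \<Rightarrow>\<^sub>L 'a"
    and Tmin Tmax :: real
  assumes "generates D A S"
    and "J \<noteq> 0"
    and "blinfun_apply J ` D \<subseteq> D"
    and "0 < Tmin" and "Tmin \<le> Tmax"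
    and "growth_condition S J Tmin Tmax"
  shows "(strongly_UGES S J (seqs_rng Tmin Tmax) \<longleftrightarrow>
            (\<exists>p c \<eta> \<mu> V. p \<ge> 1 \<and> c \<ge> 1 \<and> \<eta> \<ge> 0 \<and> 0 < \<mu> \<and> \<mu> \<le> 1 \<and> \<eta> + (- ln \<mu>) > 0 \<and>
               clock_Lyapunov S J Tmin Tmax p c \<eta> \<mu> V)) \<and>
         (strongly_UGES S J (seqs_rng Tmin Tmax) \<longleftrightarrow>
            (\<exists>p c \<mu> V. p \<ge> 1 \<and> c \<ge> 1 \<and> 0 < \<mu> \<and> \<mu> < 1 \<and>
               uniform_discrete_Lyapunov {J o\<^sub>L S \<theta> |\<theta>. \<theta> \<in> {Tmin..Tmax}} p c \<mu> V))"
    (is "(?UGES \<longleftrightarrow> ?clock) \<and> (_ \<longleftrightarrow> ?discrete)")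
proof -
  have C0: "C0_semigroup S" using assms(1) by (simp add: generates_def)
  obtain B where "1 \<le> B" and "\<And>t. t \<in> {0..Tmax} \<Longrightarrow> norm (S t) \<le> B"
    using growth_condition_imp_bounded[OF C0 assms(4-6)] by blast
  then interpret impulsive_flow S J Tmin Tmax B
    using C0 assms(4,5) by unfold_locales
  have discrete_UGES: ?UGES if ?discrete
    using that discrete_Lyapunov_imp_product_decay product_decay_imp_UGES by blast
  have clock_discrete: ?discrete if ?clock
  proof -
    obtain p c \<eta> \<mu> V where *: "p \<ge> 1" "c \<ge> 1" "\<eta> \<ge> 0" "0 < \<mu>" "\<mu> \<le> 1" "\<eta> + (- ln \<mu>) > 0"
      and V: "clock_Lyapunov S J Tmin Tmax p c \<eta> \<mu> V" using \<open>?clock\<close> by blast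
    have "\<mu> * exp (- \<eta> * Tmin) < 1"
    proof (cases "\<mu> = 1")
      case True
      then show ?thesis using * assms(4) by simp
    next
      case False
      have "\<mu> * exp (- \<eta> * Tmin) \<le> \<mu> * 1" using * assms(4) by (intro mult_left_mono) auto
      also have "\<dots> < 1" using False * by simp
      finally show ?thesis .
    qed
    then show ?thesis
      using clock_Lyapunov_imp_discrete_Lyapunov[OF *(3,4) V] *(1,2,4)
      by (intro exI conjI) auto
  qed
  have UGES_both: "?clock \<and> ?discrete" if ?UGES
  proof -
    obtain C \<nu> where decay: "product_decay S J {Tmin..Tmax} C \<nu>"
      using UGES_imp_product_decay[OF C0 assms(4,5) \<open>?UGES\<close>] .
    then have C: "1 \<le> C" "0 < \<nu>" "\<nu> < 1" by (auto simp: product_decay_def)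
    obtain c V where c: "c \<ge> 1" and V: "clock_Lyapunov S J Tmin Tmax 1 c 0 \<nu> V"
      using product_decay_imp_clock_Lyapunov[OF decay] .
    have ?clock
      using C c V by (intro exI[of _ 1] exI[of _ c] exI[of _ 0] exI[of _ \<nu>] exI[of _ V]) auto
    moreover obtain V' where "uniform_discrete_Lyapunov jump_family 1 C \<nu> V'"
      using product_decay_imp_discrete_Lyapunov[OF decay] .
    then have ?discrete
      using C by (intro exI[of _ 1] exI[of _ C] exI[of _ \<nu>] exI[of _ V']) auto
    ultimately show ?thesis ..
  qed
  show ?thesis using discrete_UGES clock_discrete UGES_both by blast
qed

end
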